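(* Let $p\in[0,1]$ and $q=1-p$. If the server has probability $p$ of winning each point on his/her serve, then the number of points $N_G$ played in the game has probability mass function $p_{N_G}(n|p)=\Pr\{N_G=n\}$ given by $$p_{N_G}(n|p)=\begin{cases}\binom{n-1}{3}p^4q^{n-4}+\binom{n-1}{3}q^4p^{n-4} & \text{for } n=4,5,6,\\[2pt] 20p^3q^3(p^2+q^2)(2pq)^{\frac{n-6}{2}-1} & \text{for } n=8,10,12,\ldots,\\[2pt] 0 & \text{otherwise.}\end{cases}$$
   Context: Tennis game: one player (the server) serves all points. Point outcomes are independent, and the server wins each point with probability $p$ (otherwise the receiver wins it). The game ends, and is won by a player, as soon as that player has won at least 4 points and is ahead by at least 2 points (so if the score reaches 3 points each, play continues until one player is ahead by two points). $N_G$ is the total number of points played when the game ends. Convention: $0^0=1$. *)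

theory Defs
  imports "HOL-Probability.Probability"
begin

text \<open>
  A course of play is a sequence \<open>w :: nat \<Rightarrow> bool\<close>, where \<open>w i\<close> means that the server wins
  the point with (zero-based) index \<open>i\<close>.  The sequence is infinite; points after the end of
  the game are irrelevant to all quantities below.
\<close>

definition server_points :: "(nat \<Rightarrow> bool) \<Rightarrow> nat \<Rightarrow> nat" where
  "server_points w n = card {i. i < n \<and> w i}"

definition receiver_points :: "(nat \<Rightarrow> bool) \<Rightarrow> nat \<Rightarrow> nat" where
  "receiver_points w n = card {i. i < n \<and> \<not> w i}"

definition winning_score :: "nat \<Rightarrow> nat \<Rightarrow> bool" where
  "winning_score a b \<longleftrightarrow> a \<ge> 4 \<and> a \<ge> b + 2"

definition game_decided :: "(nat \<Rightarrow> bool) \<Rightarrow> nat \<Rightarrow> bool" where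
  "game_decided w n \<longleftrightarrow>
     winning_score (server_points w n) (receiver_points w n) \<or>
     winning_score (receiver_points w n) (server_points w n)"

text \<open>The value \<open>\<infinity>\<close> stands for a game that never ends.\<close>

definition N_G :: "(nat \<Rightarrow> bool) \<Rightarrow> enat" where
  "N_G w = (if \<exists>n. game_decided w n then enat (LEAST n. game_decided w n) else \<infinity>)"

end

theory Submission
  imports Defs
begin

text \<open>
  Let \<open>s n\<close> be the probability that the game is still running after \<open>n\<close> points, i.e. that
  \<open>N_G > n\<close>.  Then \<open>Pr (N_G = n + 1) = s n - s (n + 1)\<close>, so it is enough to know \<open>s\<close>, and whether
  \<open>N_G > n\<close> holds is decided by the first \<open>n\<close> points.

  Up to six points the history does not matter (\<open>N_G_gr_iff_scores\<close>): a player with four of at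
  most six points leads by two, hence the game runs exactly as long as neither player has four points.
  The score is binomially distributed (\<open>prob_server_points\<close>), which gives
  \<open>s 0 = \<dots> = s 3 = 1\<close> and explicit polynomials for \<open>s 4\<close>, \<open>s 5\<close> and \<open>s 6 = 20 p\<^sup>3 q\<^sup>3\<close>.

  If the game is running after \<open>2 k + 6\<close> points, the score is level (\<open>level_if_N_G_gr\<close>).  The next
  point cannot end the game, so \<open>s (2 k + 7) = s (2 k + 6)\<close>, and the one after it ends the game
  unless the two points are won by different players.  By independence of these two points from the
  earlier ones, \<open>s (2 k + 8) = 2 p q s (2 k + 6)\<close>, so \<open>s (2 k + 6) = 20 p\<^sup>3 q\<^sup>3 (2 p q)\<^sup>k\<close>.

  The case \<open>n \<ge> 8\<close> of the mass function now follows from \<open>1 - 2 p q = p\<^sup>2 + q\<^sup>2\<close>, and the game ends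
  almost surely because \<open>2 p q \<le> 1/2\<close> forces \<open>s n\<close> to \<open>0\<close>.
\<close>

section \<open>The course of a single game\<close>

lemma server_points_0 [simp]: "server_points w 0 = 0"
  by (simp add: server_points_def)

lemma server_points_Suc:
  "server_points w (Suc n) = server_points w n + (if w n then 1 else 0)"
proof -
  have "{i. i < Suc n \<and> w i} = (if w n then insert n {i. i < n \<and> w i} else {i. i < n \<and> w i})"
    by (auto simp: less_Suc_eq)
  then show ?thesis
    by (simp add: server_points_def)
qed

lemma receiver_points_eq_server_points: "receiver_points w n = server_points (\<lambda>i. \<not> w i) n"
  by (simp add: server_points_def receiver_points_def)

lemma receiver_points_Suc:
  "receiver_points w (Suc n) = receiver_points w n + (if w n then 0 else 1)"
  by (simp add: receiver_points_eq_server_points server_points_Suc)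

lemma points_add: "server_points w n + receiver_points w n = n"
  by (induction n) (simp_all add: receiver_points_eq_server_points server_points_Suc)

lemma server_points_mono: "m \<le> n \<Longrightarrow> server_points w m \<le> server_points w n"
  unfolding server_points_def by (intro card_mono) auto

lemma receiver_points_mono: "m \<le> n \<Longrightarrow> receiver_points w m \<le> receiver_points w n"
  by (simp add: receiver_points_eq_server_points server_points_mono)

lemma server_points_cong:
  "(\<And>i. i < n \<Longrightarrow> v i = w i) \<Longrightarrow> server_points v n = server_points w n"
  unfolding server_points_def by (rule arg_cong[where f = card]) auto

lemma receiver_points_cong:
  "(\<And>i. i < n \<Longrightarrow> v i = w i) \<Longrightarrow> receiver_points v n = receiver_points w n"
  unfolding receiver_points_eq_server_points by (rule server_points_cong) simp

lemma game_decided_cong: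
  assumes "\<And>i. i < n \<Longrightarrow> v i = w i"
  shows "game_decided v n = game_decided w n"
  using server_points_cong[of n v w] receiver_points_cong[of n v w] assms
  by (simp add: game_decided_def)

lemma N_G_gr_iff: "enat n < N_G w \<longleftrightarrow> (\<forall>m\<le>n. \<not> game_decided w m)"
proof (cases "\<exists>n. game_decided w n")
  case True
  then have "game_decided w (LEAST n. game_decided w n)"
    by (rule LeastI_ex)
  then have "(\<forall>m\<le>n. \<not> game_decided w m) \<longleftrightarrow> n < (LEAST n. game_decided w n)"
    by (meson le_less_trans not_le_imp_less not_less_Least)
  then show ?thesis
    using True by (simp add: N_G_def)
qed (auto simp: N_G_def)

lemma N_G_gr_Suc_iff: "enat (Suc n) < N_G w \<longleftrightarrow> enat n < N_G w \<and> \<not> game_decided w (Suc n)"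
  by (auto simp: N_G_gr_iff le_Suc_eq)

lemma N_G_gr_cong:
  assumes "\<And>i. i < n \<Longrightarrow> v i = w i"
  shows "enat n < N_G v \<longleftrightarrow> enat n < N_G w"
  unfolding N_G_gr_iff using assms by (auto cong: game_decided_cong)

text \<open>
  Four points out of at most six are automatically a lead of two, so here the current score alone
  decides; earlier scores were even lower.
\<close>

lemma N_G_gr_iff_scores:
  assumes "n \<le> 6"
  shows "enat n < N_G w \<longleftrightarrow> server_points w n \<le> 3 \<and> receiver_points w n \<le> 3"
proof
  assume "enat n < N_G w"
  then have "\<not> game_decided w n"
    by (simp add: N_G_gr_iff)
  then show "server_points w n \<le> 3 \<and> receiver_points w n \<le> 3"
    using points_add[of w n] assms by (auto simp: game_decided_def winning_score_def)
next
  assume scores: "server_points w n \<le> 3 \<and> receiver_points w n \<le> 3"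
  have "\<not> game_decided w m" if "m \<le> n" for m
    using scores server_points_mono[OF that, of w] receiver_points_mono[OF that, of w]
    by (simp add: game_decided_def winning_score_def)
  then show "enat n < N_G w"
    by (simp add: N_G_gr_iff)
qed

lemma N_G_gr_if_le_3:
  assumes "n \<le> 3"
  shows "enat n < N_G w"
  using assms points_add[of w n] by (simp add: N_G_gr_iff_scores)

lemma game_decided_odd_step:
  assumes "server_points w n = receiver_points w n"
  shows "\<not> game_decided w (Suc n)"
  using assms
  by (simp add: game_decided_def winning_score_def server_points_Suc receiver_points_Suc)

text \<open>
  With six or more points played, a level score gives each player at least three, so the
  four-point condition holds for whoever wins the next two points.
\<close>

lemma game_decided_two_steps:
  assumes "server_points w n = receiver_points w n" "6 \<le> n"
  shows "game_decided w (Suc (Suc n)) \<longleftrightarrow> w n = w (Suc n)"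
  using assms points_add[of w n]
  by (auto simp: game_decided_def winning_score_def server_points_Suc receiver_points_Suc)

text \<open>
  At six points a running game stands at 3-3, and from then on it survives a pair of points only if
  the pair is split, which keeps the score level.
\<close>

lemma level_if_N_G_gr:
  assumes "enat (2 * k + 6) < N_G w"
  shows "server_points w (2 * k + 6) = receiver_points w (2 * k + 6)"
  using assms
proof (induction k)
  case 0
  then show ?case
    using points_add[of w 6] by (simp add: N_G_gr_iff_scores)
next
  case (Suc k)
  let ?n = "2 * k + 6"
  have gr: "enat ?n < N_G w" "\<not> game_decided w (Suc (Suc ?n))"
    using Suc.prems by (auto simp: N_G_gr_iff)
  have level: "server_points w ?n = receiver_points w ?n"
    by (rule Suc.IH[OF gr(1)])
  then have "w ?n \<noteq> w (Suc ?n)"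
    using gr(2) game_decided_two_steps[OF level] by simp
  then show ?case
    using level by (auto simp: server_points_Suc receiver_points_Suc numeral_eq_Suc)
qed

lemma N_G_gr_odd_step: "enat (2 * k + 7) < N_G w \<longleftrightarrow> enat (2 * k + 6) < N_G w"
proof -
  have "2 * k + 7 = Suc (2 * k + 6)"
    by simp
  then show ?thesis
    using N_G_gr_Suc_iff[of "2 * k + 6" w] game_decided_odd_step[OF level_if_N_G_gr, of k w]
    by metis
qed

lemma N_G_gr_two_steps:
  "enat (2 * k + 8) < N_G w \<longleftrightarrow>
    enat (2 * k + 6) < N_G w \<and> w (2 * k + 6) \<noteq> w (Suc (2 * k + 6))"
proof -
  have "2 * k + 8 = Suc (2 * k + 7)" "2 * k + 7 = Suc (2 * k + 6)"
    by simp_all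
  then show ?thesis
    using N_G_gr_Suc_iff[of "2 * k + 7" w] N_G_gr_odd_step[of k w]
      game_decided_two_steps[OF level_if_N_G_gr, of k w]
    by (metis le_add2)
qed

section \<open>Independent points with a constant success probability\<close>

locale independent_points = prob_space M for M :: "'a measure" +
  fixes X :: "nat \<Rightarrow> 'a \<Rightarrow> bool" and p q :: real
  assumes p_nonneg: "0 \<le> p" and p_le_1: "p \<le> 1" and q_eq: "q = 1 - p"
    and indep_points: "indep_vars (\<lambda>_. count_space UNIV) X UNIV"
    and prob_point: "\<And>i. prob {\<omega> \<in> space M. X i \<omega>} = p"
begin

abbreviation Point_event :: "((nat \<Rightarrow> bool) \<Rightarrow> bool) \<Rightarrow> 'a set" where
  "Point_event P \<equiv> {\<omega> \<in> space M. P (\<lambda>i. X i \<omega>)}"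

definition point_prob :: "bool \<Rightarrow> real" where
  "point_prob b = (if b then p else q)"

definition determined_by_first :: "nat \<Rightarrow> ((nat \<Rightarrow> bool) \<Rightarrow> bool) \<Rightarrow> bool" where
  "determined_by_first n P \<longleftrightarrow> (\<forall>v w. (\<forall>i<n. v i = w i) \<longrightarrow> P v = P w)"

lemma determined_by_firstD:
  "determined_by_first n P \<Longrightarrow> (\<And>i. i < n \<Longrightarrow> v i = w i) \<Longrightarrow> P v = P w"
  by (auto simp: determined_by_first_def)

lemma determined_by_first_server_points: "determined_by_first n (\<lambda>w. server_points w n = a)"
  by (auto simp: determined_by_first_def cong: server_points_cong)

lemma determined_by_first_N_G: "determined_by_first n (\<lambda>w. enat n < N_G w)"
  unfolding determined_by_first_def by (intro allI impI N_G_gr_cong) simp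

lemma measurable_point [measurable]: "X i \<in> measurable M (count_space UNIV)"
  using indep_points by (auto simp: indep_vars_def)

lemma prob_point_eq: "prob {\<omega> \<in> space M. X i \<omega> = b} = point_prob b"
proof (cases b)
  case False
  have "prob {\<omega> \<in> space M. \<not> X i \<omega>} = 1 - prob {\<omega> \<in> space M. X i \<omega>}"
    by (rule prob_neg) simp
  with False show ?thesis
    by (simp add: point_prob_def prob_point flip: q_eq)
qed (simp add: point_prob_def prob_point)

lemma prob_cylinder:
  "prob {\<omega> \<in> space M. \<forall>i<n. X i \<omega> = v i} = (\<Prod>i<n. point_prob (v i))"
proof (cases "n = 0")
  case True
  then show ?thesis
    by (simp add: prob_space)
next
  case False
  have "prob (\<Inter>i\<in>{..<n}. X i -` {v i} \<inter> space M)
      = (\<Prod>i<n. prob (X i -` {v i} \<inter> space M))"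
    using False by (intro indep_varsD[OF indep_points]) auto
  also have "(\<Inter>i\<in>{..<n}. X i -` {v i} \<inter> space M) = {\<omega> \<in> space M. \<forall>i<n. X i \<omega> = v i}"
    using False by auto
  also have "(\<Prod>i<n. prob (X i -` {v i} \<inter> space M)) = (\<Prod>i<n. point_prob (v i))"
    by (intro prod.cong refl) (simp add: prob_point_eq vimage_def Int_def conj_commute)
  finally show ?thesis .
qed

text \<open>
  Only finitely many courses of the first \<open>n\<close> points exist, so an event about these points is a
  finite disjoint union of cylinders; \<open>PiE_dflt\<close> picks the one representative that is
  \<open>False\<close> from \<open>n\<close> on.
\<close>

abbreviation courses :: "nat \<Rightarrow> ((nat \<Rightarrow> bool) \<Rightarrow> bool) \<Rightarrow> (nat \<Rightarrow> bool) set" where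
  "courses n P \<equiv> {v \<in> PiE_dflt {..<n} False (\<lambda>_. UNIV). P v}"

lemma finite_courses: "finite (courses n P)"
  by (intro finite_Collect_conjI disjI1) (simp add: finite_PiE_dflt)

lemma Point_event_eq_Union:
  assumes "determined_by_first n P"
  shows "Point_event P = (\<Union>v\<in>courses n P. {\<omega> \<in> space M. \<forall>i<n. X i \<omega> = v i})"
proof (intro equalityI subsetI)
  fix \<omega> assume \<omega>: "\<omega> \<in> Point_event P"
  let ?v = "\<lambda>i. if i < n then X i \<omega> else False"
  have "P ?v = P (\<lambda>i. X i \<omega>)"
    by (rule determined_by_firstD[OF assms]) simp
  then have "?v \<in> courses n P"
    using \<omega> by (simp add: PiE_dflt_def)
  then show "\<omega> \<in> (\<Union>v\<in>courses n P. {\<omega> \<in> space M. \<forall>i<n. X i \<omega> = v i})"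
    by (rule UN_I) (use \<omega> in simp)
next
  fix \<omega> assume "\<omega> \<in> (\<Union>v\<in>courses n P. {\<omega> \<in> space M. \<forall>i<n. X i \<omega> = v i})"
  then obtain v where v: "P v" "\<omega> \<in> space M" "\<forall>i<n. X i \<omega> = v i"
    by blast
  then have "P (\<lambda>i. X i \<omega>) = P v"
    by (intro determined_by_firstD[OF assms]) simp
  with v show "\<omega> \<in> Point_event P"
    by simp
qed

lemma sets_Point_event:
  assumes "determined_by_first n P"
  shows "Point_event P \<in> events"
  unfolding Point_event_eq_Union[OF assms] using finite_courses
  by (intro sets.finite_UN) (auto intro!: measurable_sets)

lemma prob_Point_event:
  assumes "determined_by_first n P"
  shows "prob (Point_event P) = (\<Sum>v\<in>courses n P. \<Prod>i<n. point_prob (v i))"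
proof -
  have "disjoint_family_on (\<lambda>v. {\<omega> \<in> space M. \<forall>i<n. X i \<omega> = v i}) (courses n P)"
    unfolding disjoint_family_on_def PiE_dflt_def by (auto simp: fun_eq_iff)
  then show ?thesis
    unfolding Point_event_eq_Union[OF assms] using finite_courses
    by (subst finite_measure_finite_Union) (auto simp: prob_cylinder)
qed

lemma determined_by_first_next:
  assumes "determined_by_first n P"
  shows "determined_by_first (Suc n) (\<lambda>w. P w \<and> w n = b)"
  unfolding determined_by_first_def
  using determined_by_firstD[OF assms] by (metis less_Suc_eq)

text \<open>
  The next point is independent of everything that the earlier points determine: extending a course by
  the outcome \<open>b\<close> multiplies the probability of its cylinder by \<open>point_prob b\<close>.
\<close>

lemma prob_next_point:
  assumes "determined_by_first n P"
  shows "prob (Point_event (\<lambda>w. P w \<and> w n = b)) = prob (Point_event P) * point_prob b"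
proof -
  have bij: "bij_betw (\<lambda>v. v(n := b)) (courses n P) (courses (Suc n) (\<lambda>w. P w \<and> w n = b))"
  proof (rule bij_betw_byWitness[where f' = "\<lambda>v. v(n := False)"])
    show "(\<lambda>v. v(n := b)) ` courses n P \<subseteq> courses (Suc n) (\<lambda>w. P w \<and> w n = b)"
      using determined_by_firstD[OF assms, of "_(n := b)"] by (auto simp: PiE_dflt_def)
    show "(\<lambda>v. v(n := False)) ` courses (Suc n) (\<lambda>w. P w \<and> w n = b) \<subseteq> courses n P"
      using determined_by_firstD[OF assms, of "_(n := False)"]
      by (auto simp: PiE_dflt_def less_Suc_eq split: if_splits)
  qed (auto simp: PiE_dflt_def fun_eq_iff)
  have "prob (Point_event (\<lambda>w. P w \<and> w n = b))
      = (\<Sum>v\<in>courses (Suc n) (\<lambda>w. P w \<and> w n = b). \<Prod>i<Suc n. point_prob (v i))"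
    by (rule prob_Point_event[OF determined_by_first_next[OF assms]])
  also have "\<dots> = (\<Sum>v\<in>courses n P. \<Prod>i<Suc n. point_prob ((v(n := b)) i))"
    by (rule sum.reindex_bij_betw[OF bij, symmetric])
  also have "\<dots> = (\<Sum>v\<in>courses n P. (\<Prod>i<n. point_prob (v i)) * point_prob b)"
    by (intro sum.cong refl) (simp add: prod.lessThan_Suc)
  also have "\<dots> = prob (Point_event P) * point_prob b"
    by (simp add: prob_Point_event[OF assms] sum_distrib_right)
  finally show ?thesis .
qed

section \<open>The probability that the game is still running\<close>

lemma prob_server_points:
  "prob (Point_event (\<lambda>w. server_points w n = a)) = real (n choose a) * p ^ a * q ^ (n - a)"
proof (induction n arbitrary: a)
  case 0
  then show ?case
    by (cases a) (simp_all add: prob_space)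
next
  case (Suc n)
  let ?E = "\<lambda>a b. Point_event (\<lambda>w. server_points w n = a \<and> w n = b)"
  have E: "?E a b \<in> events" for a b
    by (rule sets_Point_event[OF determined_by_first_next[OF determined_by_first_server_points]])
  have prob_E: "prob (?E a b) = real (n choose a) * p ^ a * q ^ (n - a) * point_prob b" for a b
    by (simp only: prob_next_point[OF determined_by_first_server_points] Suc.IH)
  show ?case
  proof (cases a)
    case 0
    have "Point_event (\<lambda>w. server_points w (Suc n) = a) = ?E 0 False"
      using 0 by (auto simp: server_points_Suc)
    then show ?thesis
      using 0 by (simp only: prob_E) (simp add: point_prob_def)
  next
    case (Suc c)
    have "Point_event (\<lambda>w. server_points w (Suc n) = a) = ?E c True \<union> ?E a False"
      using Suc by (auto simp: server_points_Suc)
    then have "prob (Point_event (\<lambda>w. server_points w (Suc n) = a))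
        = prob (?E c True) + prob (?E a False)"
      using finite_measure_Union[OF E E, of c True a False] by auto
    also have "\<dots> = real (n choose c) * p ^ a * q ^ (n - c)
        + real (n choose a) * p ^ a * (q ^ (n - a) * q)"
      using Suc by (simp only: prob_E) (simp add: point_prob_def)
    \<comment> \<open>truncated subtraction is harmless: the binomial coefficient vanishes for \<open>a > n\<close>\<close>
    also have "real (n choose a) * p ^ a * (q ^ (n - a) * q)
        = real (n choose a) * p ^ a * q ^ (n - c)"
    proof (cases "a \<le> n")
      case True
      then have "n - c = Suc (n - a)"
        using Suc by simp
      then show ?thesis
        by simp
    qed (simp add: binomial_eq_0)
    finally show ?thesis
      using Suc by (simp add: algebra_simps)
  qed
qed

definition running_prob :: "nat \<Rightarrow> real" where
  "running_prob n = prob (Point_event (\<lambda>w. enat n < N_G w))"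

lemma sets_N_G_gr: "Point_event (\<lambda>w. enat n < N_G w) \<in> events"
  by (rule sets_Point_event[OF determined_by_first_N_G])

lemma running_prob_le_3: "n \<le> 3 \<Longrightarrow> running_prob n = 1"
  by (simp add: running_prob_def N_G_gr_if_le_3 prob_space)

text \<open>
  The range of \<open>a\<close> expresses that the server has at most three points and the receiver, with
  \<open>n - a\<close> points, as well.
\<close>

lemma running_prob_le_6:
  assumes "n \<le> 6"
  shows "running_prob n = (\<Sum>a = n - 3..3. real (n choose a) * p ^ a * q ^ (n - a))"
proof -
  have "enat n < N_G w \<longleftrightarrow> (\<exists>a\<in>{n - 3..3}. server_points w n = a)" for w
    using points_add[of w n] assms by (auto simp: N_G_gr_iff_scores)
  then have "Point_event (\<lambda>w. enat n < N_G w)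
      = (\<Union>a\<in>{n - 3..3}. Point_event (\<lambda>w. server_points w n = a))"
    by (simp only:) blast
  moreover have "disjoint_family_on (\<lambda>a. Point_event (\<lambda>w. server_points w n = a)) {n - 3..3}"
    by (auto simp: disjoint_family_on_def)
  ultimately have "running_prob n
      = (\<Sum>a = n - 3..3. prob (Point_event (\<lambda>w. server_points w n = a)))"
    unfolding running_prob_def
    using sets_Point_event[OF determined_by_first_server_points]
    by (simp only:) (intro finite_measure_finite_Union; auto)
  then show ?thesis
    by (simp only: prob_server_points)
qed

lemma running_prob_odd: "running_prob (2 * k + 7) = running_prob (2 * k + 6)"
  by (simp only: running_prob_def N_G_gr_odd_step)

text \<open>
  The next two points must be split; either order has probability \<open>p q\<close>, independently of the
  first \<open>2 k + 6\<close> points.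
\<close>

lemma running_prob_two_steps: "running_prob (2 * k + 8) = 2 * p * q * running_prob (2 * k + 6)"
proof -
  let ?n = "2 * k + 6"
  let ?E = "\<lambda>b. Point_event (\<lambda>w. (enat ?n < N_G w \<and> w ?n = b) \<and> w (Suc ?n) = (\<not> b))"
  note next1 = determined_by_first_next[OF determined_by_first_N_G]
  have E: "?E b \<in> events" for b
    by (rule sets_Point_event[OF determined_by_first_next[OF next1]])
  have prob_E: "prob (?E b) = p * q * running_prob ?n" for b
    unfolding running_prob_def
    by (cases b; simp only: prob_next_point[OF next1] prob_next_point[OF determined_by_first_N_G])
      (simp_all add: point_prob_def)
  have "Point_event (\<lambda>w. enat (2 * k + 8) < N_G w) = ?E True \<union> ?E False"
    unfolding N_G_gr_two_steps by auto
  then have "running_prob (2 * k + 8) = prob (?E True) + prob (?E False)"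
    unfolding running_prob_def using finite_measure_Union[OF E E, of True False] by auto
  then show ?thesis
    by (simp only: prob_E)
qed

lemma running_prob_even: "running_prob (2 * k + 6) = 20 * p ^ 3 * q ^ 3 * (2 * p * q) ^ k"
proof (induction k)
  case 0
  then show ?case
    by (simp add: running_prob_le_6 eval_nat_numeral)
next
  case (Suc k)
  then show ?case
    using running_prob_two_steps[of k] by (simp add: algebra_simps)
qed

section \<open>The distribution of the number of points\<close>

lemma sets_N_G_eq: "Point_event (\<lambda>w. N_G w = x) \<in> events"
proof (cases x)
  case (enat n)
  show ?thesis
  proof (cases n)
    case 0
    then have "N_G w \<noteq> x" for w
      using enat N_G_gr_if_le_3[of 0 w] by auto
    then show ?thesis
      by simp
  next
    case (Suc m)
    have "Point_event (\<lambda>w. N_G w = x)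
        = Point_event (\<lambda>w. enat m < N_G w) - Point_event (\<lambda>w. enat n < N_G w)"
      using enat Suc by (auto simp: not_less) (metis Suc_ile_eq antisym)
    then show ?thesis
      by (simp only: sets_N_G_gr sets.Diff)
  qed
next
  case infinity
  have "N_G w = \<infinity> \<longleftrightarrow> (\<forall>n. enat n < N_G w)" for w
    by (cases "N_G w") auto
  then have "Point_event (\<lambda>w. N_G w = x) = (\<Inter>n. Point_event (\<lambda>w. enat n < N_G w))"
    using infinity by auto
  then show ?thesis
    using sets_N_G_gr by (auto intro!: sets.countable_INT)
qed

lemma measurable_N_G: "(\<lambda>\<omega>. N_G (\<lambda>i. X i \<omega>)) \<in> measurable M (count_space UNIV)"
  using sets_N_G_eq
  by (subst measurable_count_space_eq_countable) (auto simp: vimage_def Int_def conj_commute)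

lemma prob_N_G_0: "prob (Point_event (\<lambda>w. N_G w = enat 0)) = 0"
proof -
  have "N_G w \<noteq> enat 0" for w
    using N_G_gr_if_le_3[of 0 w] by auto
  then show ?thesis
    by simp
qed

lemma prob_N_G_Suc:
  "prob (Point_event (\<lambda>w. N_G w = enat (Suc n))) = running_prob n - running_prob (Suc n)"
proof -
  have "Point_event (\<lambda>w. N_G w = enat (Suc n))
      = Point_event (\<lambda>w. enat n < N_G w) - Point_event (\<lambda>w. enat (Suc n) < N_G w)"
    by (auto simp: not_less) (metis Suc_ile_eq antisym)
  moreover have "Point_event (\<lambda>w. enat (Suc n) < N_G w) \<subseteq> Point_event (\<lambda>w. enat n < N_G w)"
    by (auto simp: N_G_gr_Suc_iff)
  ultimately show ?thesis
    unfolding running_prob_def by (simp only: finite_measure_Diff[OF sets_N_G_gr sets_N_G_gr])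
qed

lemma AE_N_G_finite: "AE \<omega> in M. N_G (\<lambda>i. X i \<omega>) \<noteq> \<infinity>"
proof -
  let ?I = "Point_event (\<lambda>w. N_G w = \<infinity>)"
  have "2 * p * q \<le> 1 / 2"
    \<comment> \<open>\<open>1/2 - 2 p q = (p - q)\<^sup>2 / 2\<close> because \<open>p + q = 1\<close>\<close>
    using zero_le_power2[of "p - q"] by (simp add: q_eq power2_eq_square algebra_simps)
  moreover have "0 \<le> 2 * p * q"
    using p_nonneg p_le_1 by (simp add: q_eq)
  ultimately have "(\<lambda>k. 20 * p ^ 3 * q ^ 3 * (2 * p * q) ^ k) \<longlonglongrightarrow> 20 * p ^ 3 * q ^ 3 * 0"
    by (intro tendsto_mult tendsto_const LIMSEQ_realpow_zero) auto
  moreover have "prob ?I \<le> 20 * p ^ 3 * q ^ 3 * (2 * p * q) ^ k" for k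
    unfolding running_prob_even[symmetric] running_prob_def
    by (rule finite_measure_mono[OF _ sets_N_G_gr]) auto
  ultimately have "prob ?I \<le> 0"
    by (intro LIMSEQ_le_const) auto
  then have "prob ?I = 0"
    using measure_nonneg[of M ?I] by simp
  then show ?thesis
    using sets_N_G_eq[of \<infinity>] by (subst AE_iff_measurable[of ?I]) (auto simp: emeasure_eq_measure)
qed

lemma running_prob_3: "running_prob 3 = 1"
  by (simp add: running_prob_le_3)

lemma running_prob_4: "running_prob 4 = 4 * p * q ^ 3 + 6 * p ^ 2 * q ^ 2 + 4 * p ^ 3 * q"
  by (simp add: running_prob_le_6 eval_nat_numeral algebra_simps)

lemma running_prob_5: "running_prob 5 = 10 * p ^ 2 * q ^ 3 + 10 * p ^ 3 * q ^ 2"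
  by (simp add: running_prob_le_6 eval_nat_numeral algebra_simps)

lemma running_prob_6: "running_prob 6 = 20 * p ^ 3 * q ^ 3"
  using running_prob_even[of 0] by simp

lemma prob_N_G:
  "prob (Point_event (\<lambda>w. N_G w = enat n)) =
    (if n \<in> {4, 5, 6} then
       real ((n - 1) choose 3) * p ^ 4 * q ^ (n - 4)
         + real ((n - 1) choose 3) * q ^ 4 * p ^ (n - 4)
     else if even n \<and> n \<ge> 8 then
       20 * p ^ 3 * q ^ 3 * (p ^ 2 + q ^ 2) * (2 * p * q) ^ ((n - 6) div 2 - 1)
     else 0)"
proof -
  consider "n = 0" | "n \<in> {1, 2, 3}" | "n = 4" | "n = 5" | "n = 6"
    | k where "n = 2 * k + 7" | k where "n = 2 * k + 8"
  proof (cases "n \<le> 6")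
    case False
    show ?thesis
    proof (cases "even n")
      case True
      then have "n = 2 * ((n - 8) div 2) + 8"
        using False by presburger
      then show ?thesis
        by (rule that)
    next
      case odd: False
      then have "n = 2 * ((n - 7) div 2) + 7"
        using False by presburger
      then show ?thesis
        by (rule that)
    qed
  qed (use that in force)
  then show ?thesis
  proof cases
    case 1
    then show ?thesis
      using prob_N_G_0 by simp
  next
    case 2
    then have "Suc (n - 1) = n" "n \<le> 3"
      by auto
    then show ?thesis
      using prob_N_G_Suc[of "n - 1"] by (simp add: running_prob_le_3)
  next
    case 3
    have "running_prob 3 - running_prob 4 = p ^ 4 + q ^ 4"
      unfolding running_prob_3 running_prob_4 q_eq by algebra
    then show ?thesis
      using 3 prob_N_G_Suc[of 3] by (simp add: eval_nat_numeral)
  next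
    case 4
    have "running_prob 4 - running_prob 5 = 4 * p ^ 4 * q + 4 * q ^ 4 * p"
      unfolding running_prob_4 running_prob_5 q_eq by algebra
    then show ?thesis
      using 4 prob_N_G_Suc[of 4] by (simp add: eval_nat_numeral)
  next
    case 5
    have "running_prob 5 - running_prob 6 = 10 * p ^ 4 * q ^ 2 + 10 * q ^ 4 * p ^ 2"
      unfolding running_prob_5 running_prob_6 q_eq by algebra
    then show ?thesis
      using 5 prob_N_G_Suc[of 5] by (simp add: eval_nat_numeral)
  next
    case (6 k)
    then have n: "n = Suc (2 * k + 6)" "Suc (2 * k + 6) = 2 * k + 7"
      by simp_all
    have "prob (Point_event (\<lambda>w. N_G w = enat n)) = 0"
      unfolding n(1) prob_N_G_Suc unfolding n(2) running_prob_odd by simp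
    then show ?thesis
      using 6 by auto
  next
    case (7 k)
    then have n: "n = Suc (2 * k + 7)" "Suc (2 * k + 7) = 2 * k + 8"
      by simp_all
    have "1 - 2 * p * q = p ^ 2 + q ^ 2"
      unfolding q_eq by algebra
    moreover have "prob (Point_event (\<lambda>w. N_G w = enat n))
        = (1 - 2 * p * q) * running_prob (2 * k + 6)"
      unfolding n(1) prob_N_G_Suc unfolding n(2) running_prob_odd running_prob_two_steps
      by (simp add: left_diff_distrib)
    ultimately show ?thesis
      using 7 by (simp add: running_prob_even)
  qed
qed

end

theorem theorem2p4:
  fixes M :: "'a measure" and X :: "nat \<Rightarrow> 'a \<Rightarrow> bool" and p q :: real
  assumes "prob_space M"
    and "0 \<le> p" and "p \<le> 1" and "q = 1 - p"
    and "prob_space.indep_vars M (\<lambda>_. count_space UNIV) X UNIV"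
    and "\<And>i. measure M {\<omega> \<in> space M. X i \<omega>} = p"
  shows "(\<lambda>\<omega>. N_G (\<lambda>i. X i \<omega>)) \<in> measurable M (count_space UNIV) \<and>
    (AE \<omega> in M. N_G (\<lambda>i. X i \<omega>) \<noteq> \<infinity>) \<and>
    (\<forall>n :: nat. measure M {\<omega> \<in> space M. N_G (\<lambda>i. X i \<omega>) = enat n} =
          (if n \<in> {4, 5, 6} then
             real ((n - 1) choose 3) * p ^ 4 * q ^ (n - 4)
               + real ((n - 1) choose 3) * q ^ 4 * p ^ (n - 4)
           else if even n \<and> n \<ge> 8 then
             20 * p ^ 3 * q ^ 3 * (p ^ 2 + q ^ 2) * (2 * p * q) ^ ((n - 6) div 2 - 1)
           else 0))"
proof -
  interpret independent_points M X p q
    using assms by (simp add: independent_points_def independent_points_axioms_def)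
  show ?thesis
    using measurable_N_G AE_N_G_finite prob_N_G by blast
qed

end
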